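(* For every $n\ge1$, the number of ascending alternation acyclic tournaments on $\{1,\ldots,n\}$ is the unsigned Genocchi number of the first kind $|G_{2n}|$.
   Context: A tournament on $\{1,\ldots,n\}$ has, for each pair $i\ne j$, exactly one of the arcs $i\to j$, $j\to i$; an arc $i\to j$ is an ascent if $i<j$, a descent if $i>j$; it is alternation acyclic if it has no directed cycle along which ascents and descents alternate. It is ascending if for each $i<n$ there is $j>i$ with $i\to j$. The Genocchi numbers of the first kind are defined by $\sum_{n\ge1}G_n t^n/n!=2t/(e^t+1)$ (so $|G_2|,|G_4|,|G_6|,|G_8|,\ldots=1,1,3,17,\ldots$). *)

theory Defs
  imports "HOL-Computational_Algebra.Computational_Algebra"
begin

text \<open>
  A tournament on the vertex set \<open>{1..n}\<close> is represented by its set of arcs: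
  \<open>(i, j) \<in> T\<close> stands for \<open>i \<rightarrow> j\<close>. Requiring \<open>T\<close> to be an irreflexive
  relation inside \<open>{1..n} \<times> {1..n}\<close> makes this representation unique, so
  tournaments may be counted by counting arc sets.
\<close>

definition tournament :: "nat \<Rightarrow> nat rel \<Rightarrow> bool" where
  "tournament n T \<longleftrightarrow>
     T \<subseteq> {1..n} \<times> {1..n} \<and> irrefl T \<and>
     (\<forall>i\<in>{1..n}. \<forall>j\<in>{1..n}. i \<noteq> j \<longrightarrow> ((i, j) \<in> T \<longleftrightarrow> (j, i) \<notin> T))"

definition ascent :: "nat \<times> nat \<Rightarrow> bool" where
  "ascent a \<longleftrightarrow> fst a < snd a"

definition descent :: "nat \<times> nat \<Rightarrow> bool" where
  "descent a \<longleftrightarrow> fst a > snd a"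

text \<open>
  The \<open>k\<close>-th arc of the cyclic sequence of vertices \<open>c\<close>. Indices are read modulo
  the length of \<open>c\<close>, so arc \<open>length c - 1\<close> leads from the last vertex back to the
  first one, and arc \<open>length c\<close> is arc \<open>0\<close> again.
\<close>

definition cycle_arc :: "nat list \<Rightarrow> nat \<Rightarrow> nat \<times> nat" where
  "cycle_arc c k = (c ! (k mod length c), c ! (Suc k mod length c))"

definition directed_cycle :: "nat rel \<Rightarrow> nat list \<Rightarrow> bool" where
  "directed_cycle T c \<longleftrightarrow>
     c \<noteq> [] \<and> distinct c \<and> (\<forall>k<length c. cycle_arc c k \<in> T)"

definition alternating :: "nat list \<Rightarrow> bool" where
  "alternating c \<longleftrightarrow>
     (\<forall>k<length c.
        (ascent (cycle_arc c k) \<and> descent (cycle_arc c (Suc k))) \<or>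
        (descent (cycle_arc c k) \<and> ascent (cycle_arc c (Suc k))))"

definition alternation_acyclic :: "nat rel \<Rightarrow> bool" where
  "alternation_acyclic T \<longleftrightarrow> \<not> (\<exists>c. directed_cycle T c \<and> alternating c)"

definition ascending :: "nat \<Rightarrow> nat rel \<Rightarrow> bool" where
  "ascending n T \<longleftrightarrow> (\<forall>i\<in>{1..<n}. \<exists>j>i. (i, j) \<in> T)"

text \<open>
  Signed Genocchi numbers of the first kind, through their exponential generating
  function. The denominator has constant term \<open>2\<close>, hence is a unit, and the
  division is the genuine quotient of formal power series.
\<close>

definition genocchi :: "nat \<Rightarrow> real" where
  "genocchi n = fact n * fps_nth (2 * fps_X / (fps_exp 1 + 1)) n"

lemma genocchi_egf:
  "Abs_fps (\<lambda>n. genocchi n / fact n) * (fps_exp 1 + 1) = 2 * fps_X"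
proof -
  have "fps_nth (fps_exp 1 + 1 :: real fps) 0 \<noteq> 0"
    by simp
  then have unit: "is_unit (fps_exp 1 + 1 :: real fps)"
    by (simp only: fps_is_unit_iff not_False_eq_True)
  have "Abs_fps (\<lambda>n. genocchi n / fact n) = 2 * fps_X / (fps_exp 1 + 1)"
    by (simp add: fps_eq_iff genocchi_def)
  then show ?thesis
    using unit by (metis dvd_div_mult_self unit_imp_dvd)
qed

end

theory Submission
  imports Defs
begin

text \<open>
  Write \<open>w \<rightarrow> i \<rightarrow> v\<close> with \<open>i < w, v\<close> as a constraint \<open>w < v\<close>. A tournament is alternation acyclic
  iff its constraints are acyclic, and then the signed count of surjections
  \<open>h : {2..n} \<rightarrow> {0..<k}\<close> that are strictly increasing along the constraints, summed over \<open>k\<close> with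
  sign \<open>(-1)\<^sup>k\<close>, is \<open>(-1)\<^sup>n\<^sup>-\<^sup>1\<close> (peel off the top level); otherwise no such \<open>h\<close> exists. Conversely, a
  fixed \<open>h\<close> is compatible with exactly \<open>\<Prod>\<^sub>i |h {i+1..n}|\<close> ascending tournaments, as the ascents at
  \<open>i\<close> must form a nonempty upper level set of \<open>h\<close> on \<open>{i+1..n}\<close>. Exchanging the two sums
  expresses the count as \<open>\<plusminus>\<Sum>\<^sub>k (-1)\<^sup>k (k!)\<^sup>2 t(n-1, k)\<close> with the central factorial numbers
  \<open>t(j+1, k) = t(j, k-1) + k\<^sup>2 t(j, k)\<close>. The exponential generating function of this sum and the
  second derivative of \<open>x tanh (x/2) = x - 2x/(e\<^sup>x + 1)\<close> solve the same linear differential equation.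
\<close>

subsection \<open>Strictly increasing surjections\<close>

text \<open>Pairs of \<open>R\<close> with an end outside \<open>V\<close> are ignored, so
  \<open>V\<close> can shrink while \<open>R\<close> stays fixed; \<open>R = {}\<close> gives all
  surjections.\<close>

definition strict_surj :: "'a rel \<Rightarrow> 'a set \<Rightarrow> nat \<Rightarrow> ('a \<Rightarrow> nat) set" where
  "strict_surj R V k =
     {h \<in> V \<rightarrow>\<^sub>E {..<k}. h ` V = {..<k} \<and> (\<forall>(w, v) \<in> R. w \<in> V \<longrightarrow> v \<in> V \<longrightarrow> h w < h v)}"

lemma finite_strict_surj: "finite V \<Longrightarrow> finite (strict_surj R V k)"
  unfolding strict_surj_def by (rule finite_subset[of _ "V \<rightarrow>\<^sub>E {..<k}"]) (auto intro: finite_PiE)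

text \<open>\<open>B\<close> is the preimage of the top value \<open>k\<close>. Surjectivity makes
  it nonempty, and no constraint leaves it inside \<open>V\<close>; conversely any such
  \<open>B\<close> can be put on top of a function on \<open>V - B\<close>.\<close>

lemma card_strict_surj_Suc:
  assumes "finite V"
  shows "card (strict_surj R V (Suc k)) =
    (\<Sum>B | B \<subseteq> {v \<in> V. \<forall>w\<in>V. (v, w) \<notin> R} \<and> B \<noteq> {}. card (strict_surj R (V - B) k))"
    (is "_ = sum _ ?Bs")
proof -
  have fin: "finite ?Bs"
    using assms by (auto intro: finite_subset[of _ "Pow V"])
  have "bij_betw (\<lambda>h. ({v \<in> V. h v = k}, restrict h (V - {v \<in> V. h v = k})))
      (strict_surj R V (Suc k)) (SIGMA B:?Bs. strict_surj R (V - B) k)"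
  proof (rule bij_betw_byWitness[where f' = "\<lambda>(B, h) v. if v \<in> B then k else h v"])
    show "\<forall>h \<in> strict_surj R V (Suc k). (\<lambda>(B, h) v. if v \<in> B then k else h v)
        ({v \<in> V. h v = k}, restrict h (V - {v \<in> V. h v = k})) = h"
      by (auto simp: strict_surj_def fun_eq_iff PiE_def extensional_def)
    show "\<forall>p \<in> (SIGMA B:?Bs. strict_surj R (V - B) k).
        (\<lambda>h. ({v \<in> V. h v = k}, restrict h (V - {v \<in> V. h v = k})))
          ((\<lambda>(B, h) v. if v \<in> B then k else h v) p) = p"
    proof
      fix p assume "p \<in> (SIGMA B:?Bs. strict_surj R (V - B) k)"
      then obtain B h where p: "p = (B, h)"
        and B: "B \<subseteq> {v \<in> V. \<forall>w\<in>V. (v, w) \<notin> R}" and h: "h \<in> strict_surj R (V - B) k"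
        by auto
      have "{v \<in> V. (if v \<in> B then k else h v) = k} = B"
        using B h by (fastforce simp: strict_surj_def PiE_def Pi_def)
      moreover have "restrict (\<lambda>v. if v \<in> B then k else h v) (V - B) = h"
        using h by (auto simp: strict_surj_def PiE_def extensional_def fun_eq_iff)
      ultimately show "(\<lambda>h. ({v \<in> V. h v = k}, restrict h (V - {v \<in> V. h v = k})))
          ((\<lambda>(B, h) v. if v \<in> B then k else h v) p) = p"
        by (simp add: p)
    qed
    show "(\<lambda>h. ({v \<in> V. h v = k}, restrict h (V - {v \<in> V. h v = k}))) ` strict_surj R V (Suc k)
        \<subseteq> (SIGMA B:?Bs. strict_surj R (V - B) k)"
    proof (rule image_subsetI)
      fix h assume h: "h \<in> strict_surj R V (Suc k)"
      let ?B = "{v \<in> V. h v = k}"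
      have im: "h ` V = {..<Suc k}" and le: "\<And>v. v \<in> V \<Longrightarrow> h v < Suc k"
        and R: "\<And>w v. (w, v) \<in> R \<Longrightarrow> w \<in> V \<Longrightarrow> v \<in> V \<Longrightarrow> h w < h v"
        using h by (auto simp: strict_surj_def)
      have "?B \<subseteq> {v \<in> V. \<forall>w\<in>V. (v, w) \<notin> R}"
        using R le by fastforce
      moreover have "k \<in> h ` V" unfolding im by simp
      then have "?B \<noteq> {}" by auto
      moreover have "h ` (V - ?B) = {..<k}"
      proof -
        have "h ` (V - ?B) = h ` V - {k}" by auto
        then show ?thesis unfolding im by auto
      qed
      moreover have "restrict h (V - ?B) \<in> (V - ?B) \<rightarrow>\<^sub>E {..<k}"
        using le by (auto simp: less_Suc_eq)
      ultimately show "(?B, restrict h (V - ?B)) \<in> (SIGMA B:?Bs. strict_surj R (V - B) k)"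
        using R by (auto simp: strict_surj_def)
    qed
    show "(\<lambda>(B, h) v. if v \<in> B then k else h v) ` (SIGMA B:?Bs. strict_surj R (V - B) k)
        \<subseteq> strict_surj R V (Suc k)"
    proof (rule image_subsetI)
      fix p assume "p \<in> (SIGMA B:?Bs. strict_surj R (V - B) k)"
      then obtain B h where p: "p = (B, h)"
        and B: "B \<subseteq> {v \<in> V. \<forall>w\<in>V. (v, w) \<notin> R}" "B \<noteq> {}" and h: "h \<in> strict_surj R (V - B) k"
        by auto
      let ?g = "\<lambda>v. if v \<in> B then k else h v"
      have "V = B \<union> (V - B)" using B by auto
      then have "?g ` V = ?g ` B \<union> ?g ` (V - B)" by (metis image_Un)
      also have "?g ` B = {k}" using B by auto
      also have "?g ` (V - B) = {..<k}" using h by (auto simp: strict_surj_def)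
      finally have "?g ` V = {..<Suc k}" by auto
      moreover have "?g \<in> V \<rightarrow>\<^sub>E {..<Suc k}"
      proof (rule PiE_I)
        fix v assume "v \<in> V"
        then show "?g v \<in> {..<Suc k}" using \<open>?g ` V = {..<Suc k}\<close> by blast
      qed (use B h in \<open>auto simp: strict_surj_def PiE_def extensional_def\<close>)
      moreover have "?g w < ?g v" if wv: "(w, v) \<in> R" "w \<in> V" "v \<in> V" for w v
      proof -
        have "w \<notin> B" using B wv by auto
        moreover have "h w < k" using h wv \<open>w \<notin> B\<close> by (auto simp: strict_surj_def)
        moreover have "h w < h v" if "v \<notin> B"
          using h wv \<open>w \<notin> B\<close> that by (auto simp: strict_surj_def)
        ultimately show ?thesis by simp
      qed
      ultimately show "(\<lambda>(B, h) v. if v \<in> B then k else h v) p \<in> strict_surj R V (Suc k)"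
        unfolding strict_surj_def p by (simp only: mem_Collect_eq prod.case) blast
    qed
  qed
  then have "card (strict_surj R V (Suc k)) = card (SIGMA B:?Bs. strict_surj R (V - B) k)"
    by (rule bij_betw_same_card)
  also have "\<dots> = (\<Sum>B\<in>?Bs. card (strict_surj R (V - B) k))"
    using fin assms by (intro card_SigmaI) (auto simp: finite_strict_surj)
  finally show ?thesis .
qed

lemma sum_alternating_nonempty_subsets:
  assumes "finite M" "M \<noteq> {}"
  shows "(\<Sum>B | B \<subseteq> M \<and> B \<noteq> {}. (-1) ^ card B) = (-1 :: int)"
proof -
  \<comment> \<open>Expanding this product of zeros gives the signed sum over all subsets.\<close>
  have "(0::int) = (\<Prod>x\<in>M. 1 - 1)"
    using assms by (auto simp: card_gt_0_iff)
  also have "\<dots> = (\<Sum>B\<in>Pow M. (-1) ^ card B)"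
    using prod_diff_conv_sum[OF assms(1), of "\<lambda>_. 1" "\<lambda>_. 1::int"] by simp
  also have "Pow M = insert {} {B. B \<subseteq> M \<and> B \<noteq> {}}" by auto
  also have "(\<Sum>B\<in>\<dots>. (-1) ^ card B) = 1 + (\<Sum>B | B \<subseteq> M \<and> B \<noteq> {}. (-1 :: int) ^ card B)"
    using assms by (subst sum.insert) (auto intro: finite_subset[of _ "Pow M"])
  finally show ?thesis by simp
qed

text \<open>Removing the top level flips the sign, and inclusion-exclusion collapses the sum over
  all top levels. The bound \<open>N\<close> is free because the sets \<open>V - B\<close>, whatever
  their size, are all summed up to the same \<open>N - 1\<close>.\<close>

lemma alternating_sum_strict_surj:
  assumes "finite V" "card V \<le> N"
    and "\<And>U. U \<subseteq> V \<Longrightarrow> U \<noteq> {} \<Longrightarrow> \<exists>v\<in>U. \<forall>w\<in>U. (v, w) \<notin> R"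
  shows "(\<Sum>k\<le>N. (-1) ^ k * int (card (strict_surj R V k))) = (-1) ^ card V"
  using assms
proof (induction V arbitrary: N rule: finite_psubset_induct)
  case (psubset V)
  show ?case
  proof (cases "V = {}")
    case True
    have "strict_surj R {} k = (if k = 0 then {\<lambda>_. undefined} else {} :: ('a \<Rightarrow> nat) set)" for k
      by (auto simp: strict_surj_def)
    then show ?thesis
      using True by (simp add: if_distrib[of card] if_distrib[of int] if_distrib[of "\<lambda>x. _ * x"] cong: if_cong)
  next
    case False
    let ?M = "{v \<in> V. \<forall>w\<in>V. (v, w) \<notin> R}"
    let ?Bs = "{B. B \<subseteq> ?M \<and> B \<noteq> {}}"
    obtain L where L: "N = Suc L"
      using psubset False by (cases N) auto
    have z: "strict_surj R V 0 = {}"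
      using False by (auto simp: strict_surj_def)
    have step: "(\<Sum>k\<le>L. (-1) ^ k * int (card (strict_surj R (V - B) k))) = (-1) ^ card V * (-1) ^ card B"
      if "B \<in> ?Bs" for B
    proof -
      have B: "B \<subseteq> V" "B \<noteq> {}" using that by auto
      have le: "card B \<le> card V" "card B > 0" "card (V - B) = card V - card B"
        using B psubset.hyps by (auto intro: card_mono simp: card_gt_0_iff finite_subset card_Diff_subset)
      have "(\<Sum>k\<le>L. (-1) ^ k * int (card (strict_surj R (V - B) k))) = (-1) ^ card (V - B)"
        using B le psubset.prems L by (intro psubset.IH) auto
      also have "\<dots> = (-1) ^ card V * (-1) ^ card B"
        using le by (simp add: minus_one_power_iff)
      finally show ?thesis .
    qed
    have "(\<Sum>k\<le>N. (-1) ^ k * int (card (strict_surj R V k))) =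
        (\<Sum>k\<le>L. (-1) ^ Suc k * int (card (strict_surj R V (Suc k))))"
      unfolding L sum.atMost_Suc_shift by (simp add: z)
    also have "\<dots> = - (\<Sum>B\<in>?Bs. \<Sum>k\<le>L. (-1) ^ k * int (card (strict_surj R (V - B) k)))"
      unfolding card_strict_surj_Suc[OF psubset.hyps]
      by (subst sum.swap) (simp add: sum_distrib_left sum_negf)
    also have "\<dots> = - ((-1) ^ card V * (\<Sum>B\<in>?Bs. (-1) ^ card B))"
      by (simp add: step sum_distrib_left)
    also have "\<dots> = (-1) ^ card V"
      using psubset.hyps psubset.prems(2)[of V] False by (subst sum_alternating_nonempty_subsets) auto
    finally show ?thesis .
  qed
qed

subsection \<open>Constraints of a tournament\<close>

text \<open>A descent followed by an ascent. The peaks of an alternating cycle form a cycle of this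
  relation.\<close>

definition forced :: "nat rel \<Rightarrow> nat rel" where
  "forced T = {(w, v). \<exists>i. i < w \<and> i < v \<and> (w, i) \<in> T \<and> (i, v) \<in> T}"

lemma tournament_arc:
  assumes "tournament n T" "(x, y) \<in> T"
  shows "x \<in> {1..n}" "y \<in> {1..n}" "x \<noteq> y"
proof -
  have T: "T \<subseteq> {1..n} \<times> {1..n}" "irrefl T"
    using assms(1) unfolding tournament_def by blast+
  show "x \<in> {1..n}" "y \<in> {1..n}"
    using T(1) assms(2) by blast+
  show "x \<noteq> y"
    using T(2) assms(2) by (auto simp: irrefl_def)
qed

lemma tournament_flip:
  assumes "tournament n T" "x \<in> {1..n}" "y \<in> {1..n}" "x \<noteq> y"
  shows "(x, y) \<in> T \<longleftrightarrow> (y, x) \<notin> T"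
  using assms unfolding tournament_def by blast

text \<open>Along an alternating cycle \<open>h\<close> strictly increases from peak to peak, yet
  the cycle returns to its start.\<close>

lemma alternation_acyclic_if_strict:
  assumes h: "\<forall>(w, v) \<in> forced T. h w < (h v :: nat)"
  shows "alternation_acyclic T"
  unfolding alternation_acyclic_def
proof
  assume "\<exists>c. directed_cycle T c \<and> alternating c"
  then obtain c where c: "directed_cycle T c" "alternating c" by blast
  define L where "L = length c"
  define a where "a k = c ! (k mod L)" for k
  have L: "L > 0" using c by (auto simp: L_def directed_cycle_def)
  have arc: "cycle_arc c k = (a k, a (Suc k))" for k
    by (simp add: cycle_arc_def a_def L_def)
  have per: "a (k mod L) = a k" "a (Suc (k mod L)) = a (Suc k)" "a (Suc (Suc (k mod L))) = a (Suc (Suc k))" for k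
    by (simp_all add: a_def mod_Suc_eq mod_Suc_Suc_eq)
  have T: "(a k, a (Suc k)) \<in> T" for k
    using c(1) L per[of k] unfolding directed_cycle_def arc L_def[symmetric]
    by (metis mod_less_divisor)
  have alt: "(a k < a (Suc k) \<and> a (Suc (Suc k)) < a (Suc k)) \<or> (a (Suc k) < a k \<and> a (Suc k) < a (Suc (Suc k)))" for k
    using c(2) L per[of k] unfolding alternating_def arc L_def[symmetric] ascent_def descent_def
    by (metis fst_conv mod_less_divisor snd_conv)
  obtain p where p: "a (Suc p) < a p"
    using alt[of 0] by blast
  have desc: "a (Suc (p + 2 * m)) < a (p + 2 * m)" for m
  proof (induction m)
    case (Suc m)
    then show ?case using alt[of "p + 2 * m"] alt[of "Suc (p + 2 * m)"] by auto
  qed (use p in simp)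
  have "h (a (p + 2 * m)) < h (a (p + 2 * Suc m))" for m
  proof -
    have "(a (p + 2 * m), a (p + 2 * Suc m)) \<in> forced T"
      using T[of "p + 2 * m"] T[of "Suc (p + 2 * m)"] desc[of m] alt[of "p + 2 * m"]
      unfolding forced_def by auto
    then show ?thesis using h by blast
  qed
  then have "strict_mono (\<lambda>m. h (a (p + 2 * m)))"
    by (simp add: strict_mono_Suc_iff)
  \<comment> \<open>Index \<open>p + 2 * L\<close> is two full turns past \<open>p\<close>, whatever
    the parity of \<open>L\<close>.\<close>
  from strict_monoD[OF this L] have "h (a (p + 2 * 0)) < h (a (p + 2 * L))" .
  then show False
    by (simp add: a_def)
qed

text \<open>Opposite constraints through \<open>i\<close> and \<open>i'\<close> close up to an
  alternating 4-cycle. The case \<open>v = w\<close> yields irreflexivity.\<close>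

lemma forced_asym:
  assumes T: "tournament n T" "alternation_acyclic T"
    and vw: "(v, w) \<in> forced T"
  shows "(w, v) \<notin> forced T"
proof
  assume "(w, v) \<in> forced T"
  then obtain i where i: "i < w" "i < v" "(w, i) \<in> T" "(i, v) \<in> T"
    by (auto simp: forced_def)
  obtain i' where i': "i' < w" "i' < v" "(v, i') \<in> T" "(i', w) \<in> T"
    using vw by (auto simp: forced_def)
  have anti: "(y, x) \<notin> T" if "(x, y) \<in> T" for x y
    using tournament_flip[OF T(1), of x y] tournament_arc[OF T(1) that] that by simp
  have "i \<noteq> i'"
    using i(3) i'(4) anti by blast
  moreover have "w \<noteq> v"
    using i(3,4) anti by blast
  ultimately have "distinct [w, i, v, i']"
    using i(1,2) i'(1,2) by simp
  then have "directed_cycle T [w, i, v, i']"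
    using i(3,4) i'(3,4) by (simp add: directed_cycle_def cycle_arc_def All_less_Suc)
  moreover have "alternating [w, i, v, i']"
    using i(1,2) i'(1,2) by (simp add: alternating_def cycle_arc_def ascent_def descent_def All_less_Suc)
  ultimately show False
    using T(2) unfolding alternation_acyclic_def by blast
qed

text \<open>
  Remove the least vertex \<open>b\<close> of \<open>U\<close> and let \<open>m\<close> be maximal among the rest. If \<open>m\<close> lies below \<open>b\<close>
  through \<open>i\<close>, then \<open>i\<close> is smaller than every vertex of \<open>U\<close>, so either orientation of \<open>{i, w}\<close>
  turns a constraint \<open>b < w\<close> into a contradiction: \<open>b\<close> is maximal.
\<close>

lemma forced_has_maximal:
  assumes T: "tournament n T" "alternation_acyclic T"
    and "U \<subseteq> {1..n}" "U \<noteq> {}"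
  shows "\<exists>v\<in>U. \<forall>w\<in>U. (v, w) \<notin> forced T"
proof -
  have "finite U" using assms(3) finite_subset by blast
  then show ?thesis using assms(3,4)
  proof (induction U rule: finite_psubset_induct)
    case (psubset U)
    note asym = forced_asym[OF T]
    define b where "b = Min U"
    have b: "b \<in> U" "\<And>u. u \<in> U \<Longrightarrow> b \<le> u"
      using psubset by (auto simp: b_def)
    show ?case
    proof (cases "U = {b}")
      case True
      then show ?thesis using asym by auto
    next
      case False
      then have "\<exists>m\<in>U - {b}. \<forall>w\<in>U - {b}. (m, w) \<notin> forced T"
        using psubset.prems b by (intro psubset.IH) auto
      then obtain m where m: "m \<in> U" "m \<noteq> b" "\<And>w. w \<in> U \<Longrightarrow> w \<noteq> b \<Longrightarrow> (m, w) \<notin> forced T"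
        by auto
      show ?thesis
      proof (cases "(m, b) \<in> forced T")
        case True
        then obtain i where i: "i < m" "i < b" "(m, i) \<in> T" "(i, b) \<in> T"
          by (auto simp: forced_def)
        have "(b, w) \<notin> forced T" if w: "w \<in> U" for w
        proof
          assume bw: "(b, w) \<in> forced T"
          then have "w \<noteq> b" using asym by blast
          have "i < w" using i b(2)[OF w] by simp
          have "i \<in> {1..n}" "w \<in> {1..n}"
            using tournament_arc[OF T(1) i(3)] w psubset.prems by auto
          then consider "(i, w) \<in> T" | "(w, i) \<in> T"
            using tournament_flip[OF T(1), of i w] \<open>i < w\<close> by blast
          then show False
          proof cases
            case 1
            then have "(m, w) \<in> forced T" using i \<open>i < w\<close> by (auto simp: forced_def)
            then show False using m w \<open>w \<noteq> b\<close> by blast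
          next
            case 2
            then have "(w, b) \<in> forced T" using i \<open>i < w\<close> by (auto simp: forced_def)
            then show False using asym bw by blast
          qed
        qed
        then show ?thesis using b by blast
      qed (use m in blast)
    qed
  qed
qed

subsection \<open>Tournaments compatible with a level function\<close>

text \<open>With \<open>t\<close> the least value of \<open>h\<close> on \<open>A\<close>, the set
  \<open>A\<close> consists of all elements of value at least \<open>t\<close>, and every value of
  \<open>h\<close> on \<open>V\<close> occurs as such a \<open>t\<close>.\<close>

lemma card_upward_closed_subsets:
  fixes h :: "'a \<Rightarrow> 'b :: linorder"
  assumes "finite V"
  shows "card {A. A \<subseteq> V \<and> A \<noteq> {} \<and> (\<forall>v\<in>A. \<forall>w\<in>V - A. h w < h v)} = card (h ` V)"
proof -
  have "bij_betw (\<lambda>t. {v \<in> V. t \<le> h v}) (h ` V)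
      {A. A \<subseteq> V \<and> A \<noteq> {} \<and> (\<forall>v\<in>A. \<forall>w\<in>V - A. h w < h v)}"
  proof (rule bij_betw_byWitness[where f' = "\<lambda>A. Min (h ` A)"])
    show "\<forall>t\<in>h ` V. Min (h ` {v \<in> V. t \<le> h v}) = t"
      using assms by (auto intro!: Min_eqI)
    show "\<forall>A\<in>{A. A \<subseteq> V \<and> A \<noteq> {} \<and> (\<forall>v\<in>A. \<forall>w\<in>V - A. h w < h v)}. {v \<in> V. Min (h ` A) \<le> h v} = A"
    proof
      fix A assume A: "A \<in> {A. A \<subseteq> V \<and> A \<noteq> {} \<and> (\<forall>v\<in>A. \<forall>w\<in>V - A. h w < h v)}"
      then have fin: "finite A" using assms finite_subset by blast
      then have "Min (h ` A) \<in> h ` A" using A by (intro Min_in) auto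
      then obtain m where m: "m \<in> A" "Min (h ` A) = h m" by auto
      show "{v \<in> V. Min (h ` A) \<le> h v} = A"
      proof
        show "{v \<in> V. Min (h ` A) \<le> h v} \<subseteq> A"
        proof
          fix v assume v: "v \<in> {v \<in> V. Min (h ` A) \<le> h v}"
          show "v \<in> A"
          proof (rule ccontr)
            assume "v \<notin> A"
            with A v m(1) have "h v < h m" by blast
            with v m(2) show False by (simp add: leD)
          qed
        qed
        show "A \<subseteq> {v \<in> V. Min (h ` A) \<le> h v}"
        proof
          fix v assume "v \<in> A"
          then show "v \<in> {v \<in> V. Min (h ` A) \<le> h v}"
            using A fin by (simp add: subset_iff)
        qed
      qed
    qed
    show "(\<lambda>A. Min (h ` A)) ` {A. A \<subseteq> V \<and> A \<noteq> {} \<and> (\<forall>v\<in>A. \<forall>w\<in>V - A. h w < h v)} \<subseteq> h ` V"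
    proof (rule image_subsetI)
      fix A assume A: "A \<in> {A. A \<subseteq> V \<and> A \<noteq> {} \<and> (\<forall>v\<in>A. \<forall>w\<in>V - A. h w < h v)}"
      then have "finite A" using assms finite_subset by blast
      then have "Min (h ` A) \<in> h ` A"
        using A by (intro Min_in) simp_all
      then show "Min (h ` A) \<in> h ` V" using A by auto
    qed
  qed auto
  then show ?thesis
    by (simp add: bij_betw_same_card)
qed

section \<open>Tournaments encoded by their ascents\<close>

definition tournament_of :: "nat \<Rightarrow> (nat \<Rightarrow> nat set) \<Rightarrow> nat rel" where
  "tournament_of n A =
     {(x, y). x \<in> {1..n} \<and> y \<in> {1..n} \<and> (x < y \<and> y \<in> A x \<or> y < x \<and> x \<notin> A y)}"

lemma tournament_tournament_of: "tournament n (tournament_of n A)"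
  unfolding tournament_def
proof (intro conjI ballI impI)
  show "tournament_of n A \<subseteq> {1..n} \<times> {1..n}"
    unfolding tournament_of_def by blast
  show "irrefl (tournament_of n A)"
    by (simp add: irrefl_def tournament_of_def)
  fix i j :: nat assume "i \<in> {1..n}" "j \<in> {1..n}" "i \<noteq> j"
  then show "(i, j) \<in> tournament_of n A \<longleftrightarrow> (j, i) \<notin> tournament_of n A"
    by (cases i j rule: linorder_cases) (simp_all add: tournament_of_def)
qed

text \<open>Vertex \<open>n\<close> has no larger vertex, so the rows over \<open>{1..<n}\<close>
  record all ascents.\<close>

lemma tournament_of_rows:
  assumes T: "tournament n T"
  shows "tournament_of n (\<lambda>i\<in>{1..<n}. {j. i < j \<and> (i, j) \<in> T}) = T"
proof -
  have "(x, y) \<in> tournament_of n (\<lambda>i\<in>{1..<n}. {j. i < j \<and> (i, j) \<in> T}) \<longleftrightarrow> (x, y) \<in> T" for x y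
  proof (cases "x \<in> {1..n} \<and> y \<in> {1..n} \<and> x \<noteq> y")
    case True
    then show ?thesis
      using tournament_flip[OF T, of x y] by (cases "x < y") (auto simp: tournament_of_def)
  next
    case False
    then show ?thesis
      using tournament_arc[OF T, of x y] by (auto simp: tournament_of_def)
  qed
  then show ?thesis
    by (intro equalityI subrelI) (simp_all only:)
qed

lemma rows_tournament_of:
  assumes "A \<in> extensional {1..<n}" "\<And>i. i \<in> {1..<n} \<Longrightarrow> A i \<subseteq> {Suc i..n}"
  shows "(\<lambda>i\<in>{1..<n}. {j. i < j \<and> (i, j) \<in> tournament_of n A}) = A"
proof
  fix i
  show "(\<lambda>i\<in>{1..<n}. {j. i < j \<and> (i, j) \<in> tournament_of n A}) i = A i"
  proof (cases "i \<in> {1..<n}")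
    case True
    have "i < j \<and> (i, j) \<in> tournament_of n A \<longleftrightarrow> j \<in> A i" for j
      using subsetD[OF assms(2)[OF True], of j] True by (auto simp: tournament_of_def)
    then show ?thesis
      using True by simp
  next
    case False
    then show ?thesis
      using extensional_arb[OF assms(1) False] by (simp only: restrict_apply if_False)
  qed
qed

text \<open>A constraint through \<open>i\<close> compares only vertices above \<open>i\<close>, by
  whether \<open>i\<close> beats them. The conditions thus decouple into one upper level set per
  \<open>i\<close>, nonempty because \<open>T\<close> is ascending.\<close>

lemma card_ascending_strict_tournaments:
  "card {T. tournament n T \<and> ascending n T \<and> (\<forall>(w, v) \<in> forced T. h w < (h v :: nat))} =
     (\<Prod>i\<in>{1..<n}. card (h ` {Suc i..n}))"
proof -
  define Ts where "Ts = {T. tournament n T \<and> ascending n T \<and> (\<forall>(w, v) \<in> forced T. h w < h v)}"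
  define As where "As i = {A. A \<subseteq> {Suc i..n} \<and> A \<noteq> {} \<and> (\<forall>v\<in>A. \<forall>w\<in>{Suc i..n} - A. h w < h v)}" for i
  let ?f = "\<lambda>T. \<lambda>i\<in>{1..<n}. {j. i < j \<and> (i, j) \<in> T}"
  have "bij_betw ?f Ts (Pi\<^sub>E {1..<n} As)"
  proof (rule bij_betw_byWitness[where f' = "tournament_of n"])
    show "\<forall>T\<in>Ts. tournament_of n (?f T) = T"
      unfolding Ts_def using tournament_of_rows by blast
    show "\<forall>A\<in>Pi\<^sub>E {1..<n} As. ?f (tournament_of n A) = A"
    proof
      fix A assume A: "A \<in> Pi\<^sub>E {1..<n} As"
      show "?f (tournament_of n A) = A"
      proof (rule rows_tournament_of)
        show "A \<in> extensional {1..<n}" using A by (simp add: PiE_def)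
        show "A i \<subseteq> {Suc i..n}" if "i \<in> {1..<n}" for i
          using PiE_mem[OF A that] by (simp add: As_def)
      qed
    qed
    show "?f ` Ts \<subseteq> Pi\<^sub>E {1..<n} As"
    proof (rule image_subsetI)
      fix T assume "T \<in> Ts"
      then have T: "tournament n T" "ascending n T" and strict: "\<And>w v. (w, v) \<in> forced T \<Longrightarrow> h w < h v"
        by (auto simp: Ts_def)
      have "{j. i < j \<and> (i, j) \<in> T} \<in> As i" if i: "i \<in> {1..<n}" for i
      proof -
        let ?A = "{j. i < j \<and> (i, j) \<in> T}"
        have "?A \<subseteq> {Suc i..n}"
          using tournament_arc[OF T(1)] by fastforce
        moreover have "?A \<noteq> {}"
          using T(2) i by (auto simp: ascending_def)
        moreover have "h w < h v" if v: "v \<in> ?A" and w: "w \<in> {Suc i..n} - ?A" for v w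
        proof -
          have "(w, i) \<in> T"
            using tournament_flip[OF T(1), of i w] i w by auto
          then have "(w, v) \<in> forced T"
            using v w by (auto simp: forced_def Suc_le_eq)
          then show ?thesis by (rule strict)
        qed
        ultimately show ?thesis unfolding As_def by blast
      qed
      then show "?f T \<in> Pi\<^sub>E {1..<n} As" by simp
    qed
    show "tournament_of n ` Pi\<^sub>E {1..<n} As \<subseteq> Ts"
    proof (rule image_subsetI)
      fix A assume A: "A \<in> Pi\<^sub>E {1..<n} As"
      have sub: "A i \<subseteq> {Suc i..n}" "A i \<noteq> {}"
        and up: "\<And>v w. v \<in> A i \<Longrightarrow> w \<in> {Suc i..n} - A i \<Longrightarrow> h w < h v" if "i \<in> {1..<n}" for i
        using PiE_mem[OF A that] by (auto simp: As_def)
      have "\<exists>j>i. (i, j) \<in> tournament_of n A" if i: "i \<in> {1..<n}" for i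
      proof -
        obtain j where "j \<in> A i" using sub(2)[OF i] by blast
        then show ?thesis
          using sub(1)[OF i] i by (intro exI[of _ j]) (auto simp: tournament_of_def)
      qed
      then have "ascending n (tournament_of n A)"
        by (simp add: ascending_def)
      moreover have "h w < h v" if wv: "(w, v) \<in> forced (tournament_of n A)" for w v
      proof -
        obtain i where i: "i < w" "i < v" "(w, i) \<in> tournament_of n A" "(i, v) \<in> tournament_of n A"
          using wv unfolding forced_def by blast
        then have "1 \<le> i" "w \<le> n" "w \<notin> A i" "v \<in> A i"
          by (auto simp: tournament_of_def)
        then show ?thesis
          using i by (intro up[of i]) auto
      qed
      ultimately show "tournament_of n A \<in> Ts"
        using tournament_tournament_of unfolding Ts_def by blast
    qed
  qed
  then have "card Ts = card (Pi\<^sub>E {1..<n} As)"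
    by (rule bij_betw_same_card)
  also have "\<dots> = (\<Prod>i\<in>{1..<n}. card (h ` {Suc i..n}))"
    by (simp add: card_PiE As_def card_upward_closed_subsets)
  finally show ?thesis unfolding Ts_def .
qed

subsection \<open>Weighted surjections\<close>

text \<open>\<open>(k!)\<^sup>2\<close> times the central factorial number \<open>t(j, k)\<close>\<close>

fun central_weight :: "nat \<Rightarrow> nat \<Rightarrow> nat" where
  "central_weight 0 k = (if k = 0 then 1 else 0)"
| "central_weight (Suc j) k = k\<^sup>2 * (central_weight j k + central_weight j (k - 1))"

lemma sum_PiE_insert:
  assumes "x \<notin> V"
  shows "(\<Sum>h\<in>Pi\<^sub>E (insert x V) F. f h) = (\<Sum>g\<in>Pi\<^sub>E V F. \<Sum>y\<in>F x. f (g(x := y)))"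
proof -
  have "(\<Sum>h\<in>Pi\<^sub>E (insert x V) F. f h) = (\<Sum>(y, g)\<in>F x \<times> Pi\<^sub>E V F. f (g(x := y)))"
    unfolding PiE_insert_eq by (subst sum.reindex[OF inj_combinator[OF assms]]) (simp add: case_prod_unfold comp_def)
  also have "\<dots> = (\<Sum>y\<in>F x. \<Sum>g\<in>Pi\<^sub>E V F. f (g(x := y)))"
    by (simp add: sum.cartesian_product)
  also have "\<dots> = (\<Sum>g\<in>Pi\<^sub>E V F. \<Sum>y\<in>F x. f (g(x := y)))"
    by (rule sum.swap)
  finally show ?thesis .
qed

text \<open>A value in \<open>S\<close> leaves the size unchanged; otherwise
  \<open>m - card S\<close> values are new, with \<open>card S\<close> equal to
  \<open>k - 1\<close>.\<close>

lemma sum_card_insert: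
  assumes S: "S \<subseteq> {..<m}"
  shows "(\<Sum>y<m. if card (insert y S) = k then 1 else 0) =
    (if card S = k then k else 0) + (if Suc (card S) = k then m - (k - 1) else 0)"
proof -
  have fin: "finite S" using S finite_subset by blast
  have "(\<Sum>y<m. if card (insert y S) = k then 1 else 0) =
     (\<Sum>y\<in>S. if card (insert y S) = k then 1 else 0) + (\<Sum>y\<in>{..<m} - S. if card (insert y S) = k then 1 else (0::nat))"
    by (subst sum.subset_diff[OF S]) (simp_all add: add.commute)
  also have "(\<Sum>y\<in>S. if card (insert y S) = k then 1 else 0) = (\<Sum>y\<in>S. if card S = k then 1 else (0::nat))"
    by (rule sum.cong) (auto simp: insert_absorb)
  also have "(\<Sum>y\<in>{..<m} - S. if card (insert y S) = k then 1 else 0) = (\<Sum>y\<in>{..<m} - S. if Suc (card S) = k then 1 else (0::nat))"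
    by (rule sum.cong) (auto simp: fin)
  finally show ?thesis
    using S by (auto simp: card_Diff_subset fin)
qed

text \<open>The codomain is independent of \<open>k\<close> because deleting the vertex
  \<open>Suc a\<close> may lose a value. Adding it back multiplies the weight by \<open>k\<close>;
  its value is one of \<open>k\<close> old or \<open>m - (k - 1)\<close> new ones. The binomial
  coefficient chooses the image.\<close>

lemma sum_image_card_weights:
  assumes "a \<le> n"
  shows "(\<Sum>h\<in>{Suc a..n} \<rightarrow>\<^sub>E {..<m}. if card (h ` {Suc a..n}) = k
      then \<Prod>i\<in>{a..<n}. card (h ` {Suc i..n}) else 0) = (m choose k) * central_weight (n - a) k"
  using assms
proof (induction a arbitrary: k rule: inc_induct)
  case base
  show ?case by (cases k) auto
next
  case (step a)
  let ?V = "{Suc (Suc a)..n}"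
  let ?w = "\<lambda>h :: nat \<Rightarrow> nat. \<Prod>i\<in>{Suc a..<n}. card (h ` {Suc i..n})"
  have V: "{Suc a..n} = insert (Suc a) ?V" and I: "{a..<n} = insert a {Suc a..<n}"
    using step.hyps by auto
  have w: "?w (g(Suc a := y)) = ?w g" for g y
    by (rule prod.cong) (auto intro!: arg_cong[of _ _ card] image_cong)
  have im: "g(Suc a := y) ` {Suc a..n} = insert y (g ` ?V)" for g :: "nat \<Rightarrow> nat" and y
    unfolding V by auto
  have "(\<Sum>h\<in>{Suc a..n} \<rightarrow>\<^sub>E {..<m}. if card (h ` {Suc a..n}) = k
      then \<Prod>i\<in>{a..<n}. card (h ` {Suc i..n}) else 0) =
    (\<Sum>h\<in>{Suc a..n} \<rightarrow>\<^sub>E {..<m}. if card (h ` {Suc a..n}) = k then k * ?w h else 0)"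
    unfolding I by (rule sum.cong) auto
  also have "\<dots> = (\<Sum>g\<in>?V \<rightarrow>\<^sub>E {..<m}. \<Sum>y<m.
      if card (insert y (g ` ?V)) = k then k * ?w g else 0)"
    by (subst V, subst sum_PiE_insert) (simp_all only: im w, simp)
  also have "\<dots> = (\<Sum>g\<in>?V \<rightarrow>\<^sub>E {..<m}. k * ?w g * (\<Sum>y<m. if card (insert y (g ` ?V)) = k then 1 else 0))"
    by (simp add: sum_distrib_left if_distrib cong: if_cong)
  \<comment> \<open>For \<open>k = 0\<close> the truncated \<open>k - 1\<close> is harmless, since
    every term has the factor \<open>k\<close>.\<close>
  also have "\<dots> = (\<Sum>g\<in>?V \<rightarrow>\<^sub>E {..<m}. k * k * (if card (g ` ?V) = k then ?w g else 0) +
      k * (m - (k - 1)) * (if card (g ` ?V) = k - 1 then ?w g else 0))"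
  proof (rule sum.cong)
    fix g assume "g \<in> ?V \<rightarrow>\<^sub>E {..<m}"
    then have "g ` ?V \<subseteq> {..<m}" by auto
    from sum_card_insert[OF this, of k]
    show "k * ?w g * (\<Sum>y<m. if card (insert y (g ` ?V)) = k then 1 else 0) =
       k * k * (if card (g ` ?V) = k then ?w g else 0) +
      k * (m - (k - 1)) * (if card (g ` ?V) = k - 1 then ?w g else 0)"
      by (cases k) (auto simp: mult_ac simp del: mult_Suc mult_Suc_right)
  qed simp
  also have "\<dots> = k * k * ((m choose k) * central_weight (n - Suc a) k) +
      k * (m - (k - 1)) * ((m choose (k - 1)) * central_weight (n - Suc a) (k - 1))"
    unfolding sum.distrib sum_distrib_left[symmetric] step.IH ..
  also have "\<dots> = (m choose k) * central_weight (n - a) k"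
  proof -
    have n: "n - a = Suc (n - Suc a)" using step.hyps by simp
    show ?thesis
    proof (cases k)
      case (Suc l)
      \<comment> \<open>Both sides count \<open>l\<close>-subsets with one further element.\<close>
      have "(m - l) * (m choose l) = Suc l * (m choose Suc l)"
        by (metis binomial_absorb_comp binomial_absorption)
      then have "(m choose l) * (m - l) = Suc l * (m choose Suc l)"
        by (simp only: mult.commute)
      then show ?thesis
        unfolding n Suc
        by (simp add: power2_eq_square distrib_left mult.assoc mult.left_commute del: binomial_Suc_Suc mult_Suc mult_Suc_right)
    qed (simp add: n)
  qed
  finally show ?case .
qed

text \<open>For \<open>a = 1\<close> and \<open>m = k\<close>, an image of size \<open>k\<close> is
  all of \<open>{..<k}\<close> and the binomial coefficient is 1.\<close>

lemma sum_surj_weights: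
  assumes "n \<ge> 1"
  shows "(\<Sum>h\<in>strict_surj {} {2..n} k. \<Prod>i\<in>{1..<n}. card (h ` {Suc i..n})) = central_weight (n - 1) k"
proof -
  have "h ` {2..n} = {..<k} \<longleftrightarrow> card (h ` {2..n}) = k" if "h \<in> {2..n} \<rightarrow>\<^sub>E {..<k}" for h
    using that card_subset_eq[of "{..<k}" "h ` {2..n}"] by auto
  then have "strict_surj {} {2..n} k = {h \<in> {2..n} \<rightarrow>\<^sub>E {..<k}. card (h ` {2..n}) = k}"
    unfolding strict_surj_def by auto
  then show ?thesis
    using sum_image_card_weights[OF assms, of k k]
    by (simp add: sum.inter_filter finite_PiE numeral_2_eq_2 del: One_nat_def)
qed

subsection \<open>Generating functions\<close>

text \<open>Closed forms: \<open>4 sinh\<^sup>2 (x/2)\<close>, \<open>cosh\<^sup>2 (x/2)\<close> and \<open>sinh x\<close>.\<close>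

definition sinh_sq :: "real fps" where
  "sinh_sq = fps_exp 1 + fps_exp (-1) - 2"

definition cosh_sq :: "real fps" where
  "cosh_sq = 1 + fps_const (1/4) * sinh_sq"

definition sinh_fps :: "real fps" where
  "sinh_fps = fps_const (1/2) * (fps_exp 1 - fps_exp (-1))"

text \<open>The classical series \<open>(2 sinh (x/2))^(2k) / (2k)!\<close> of the central factorial
  numbers, in powers \<open>x^(2j)/(2j)!\<close>, scaled by \<open>(k!)^2\<close>.\<close>

definition weight_egf :: "nat \<Rightarrow> real fps" where
  "weight_egf k = fps_const ((fact k)\<^sup>2 / fact (2 * k)) * sinh_sq ^ k"

section \<open>Derivatives and coefficients of the weight series\<close>

lemma exp_mult_exp_minus: "fps_exp (1::real) * fps_exp (-1) = 1"
  by (simp flip: fps_exp_add_mult)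

lemma deriv_sinh_sq: "fps_deriv sinh_sq = 2 * sinh_fps"
  by (simp add: sinh_sq_def sinh_fps_def fps_eq_iff fps_numeral_nth numeral_fps_const)

lemma deriv_sinh: "2 * fps_deriv sinh_fps = sinh_sq + 2"
  by (simp add: sinh_sq_def sinh_fps_def fps_eq_iff fps_numeral_nth numeral_fps_const)

lemma sinh_squared: "sinh_fps\<^sup>2 = sinh_sq * cosh_sq"
proof -
  have "4 * (fps_const (1/2))\<^sup>2 = (1 :: real fps)" "4 * fps_const (1/4) = (1 :: real fps)"
    by (simp_all add: numeral_fps_const power2_eq_square)
  then have "4 * sinh_fps\<^sup>2 = 4 * (sinh_sq * cosh_sq)"
    using exp_mult_exp_minus unfolding sinh_fps_def sinh_sq_def cosh_sq_def by algebra
  then show ?thesis by simp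
qed

lemma deriv_sinh_sq_power:
  "fps_deriv (sinh_sq ^ Suc m) = of_nat (2 * Suc m) * sinh_sq ^ m * sinh_fps"
  by (simp add: fps_deriv_power' deriv_sinh_sq algebra_simps del: power_Suc)

text \<open>The derivative of \<open>sinh_sq ^ k\<close> brings one factor \<open>sinh_fps\<close>;
  a second one restores the power, as \<open>sinh_squared\<close> shows. This evaluates the mixed
  term of the differential equation.\<close>

lemma deriv_weight_egf:
  "sinh_fps * fps_deriv (weight_egf k) = fps_const (2 * real k) * cosh_sq * weight_egf k"
proof (cases k)
  case (Suc m)
  have "sinh_fps * fps_deriv (weight_egf k) =
     fps_const ((fact k)\<^sup>2 / fact (2 * k)) * of_nat (2 * k) * sinh_sq ^ m * sinh_fps\<^sup>2"
    unfolding weight_egf_def Suc fps_deriv_mult deriv_sinh_sq_power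
    by (simp add: power2_eq_square mult_ac del: of_nat_Suc power_Suc fact_Suc of_nat_mult)
  also have "\<dots> = fps_const (real (2 * k)) * cosh_sq * weight_egf k"
    unfolding sinh_squared weight_egf_def Suc fps_of_nat
    by (simp add: mult_ac del: of_nat_Suc fact_Suc of_nat_mult fps_const_mult)
  finally show ?thesis by simp
qed (simp add: weight_egf_def)

lemma deriv2_sinh_sq_power:
  "fps_deriv (fps_deriv (sinh_sq ^ Suc m)) =
     of_nat ((Suc m)\<^sup>2) * sinh_sq ^ Suc m + of_nat (2 * Suc m * (2 * m + 1)) * sinh_sq ^ m"
proof -
  have d: "fps_deriv (fps_deriv (sinh_sq ^ Suc m)) = of_nat (Suc m) *
      (2 * fps_deriv (sinh_sq ^ m) * sinh_fps + sinh_sq ^ m * (2 * fps_deriv sinh_fps))"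
    by (simp add: deriv_sinh_sq_power algebra_simps del: power_Suc)
  have "fps_deriv (sinh_sq ^ m) * sinh_fps = of_nat (2 * m) * sinh_sq ^ m * cosh_sq"
  proof (cases m)
    case (Suc p)
    then show ?thesis
      using sinh_squared unfolding Suc deriv_sinh_sq_power
      by (simp add: power2_eq_square mult.assoc mult.left_commute)
  qed simp
  moreover have "4 * cosh_sq = 4 + sinh_sq"
    by (simp add: cosh_sq_def numeral_fps_const algebra_simps flip: mult.assoc)
  moreover have "2 * (of_nat (2 * m) * sinh_sq ^ m * cosh_sq) = of_nat m * sinh_sq ^ m * (4 * cosh_sq)"
    by simp
  ultimately have "2 * (fps_deriv (sinh_sq ^ m) * sinh_fps) = of_nat m * sinh_sq ^ m * (4 + sinh_sq)"
    by metis
  then show ?thesis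
    unfolding d deriv_sinh by (simp add: algebra_simps power2_eq_square)
qed

text \<open>The normalisation of \<open>weight_egf\<close> gives both terms the same coefficient, so
  this is the recursion of \<open>central_weight\<close>, two derivatives being one step in
  \<open>j\<close>.\<close>

lemma deriv2_weight_egf:
  "fps_deriv (fps_deriv (weight_egf k)) =
     fps_const ((real k)\<^sup>2) * (weight_egf k + weight_egf (k - 1))"
proof (cases k)
  case (Suc m)
  have c: "(fact (Suc m))\<^sup>2 / fact (2 * Suc m) * real (2 * Suc m * (2 * m + 1)) =
      (real (Suc m))\<^sup>2 * ((fact m)\<^sup>2 / fact (2 * m))"
    by (simp add: divide_simps power2_eq_square del: of_nat_Suc) (simp add: algebra_simps)
  have "fps_deriv (fps_deriv (weight_egf k)) =
      fps_const ((fact k)\<^sup>2 / fact (2 * k)) * fps_const ((real k)\<^sup>2) * sinh_sq ^ k +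
      fps_const ((fact (Suc m))\<^sup>2 / fact (2 * Suc m) * real (2 * Suc m * (2 * m + 1))) * sinh_sq ^ m"
    unfolding weight_egf_def Suc fps_deriv_mult_const_left deriv2_sinh_sq_power
      fps_const_mult[symmetric] fps_of_nat[symmetric] of_nat_power[symmetric]
    by (simp add: algebra_simps del: of_nat_Suc fact_Suc of_nat_mult fps_const_mult power_Suc)
  then show ?thesis
    unfolding c by (simp add: weight_egf_def Suc algebra_simps del: of_nat_Suc fact_Suc power_Suc flip: fps_const_mult)
qed (simp add: weight_egf_def)

lemma sinh_sq_power_nth: "i < 2 * k \<Longrightarrow> fps_nth (sinh_sq ^ k) i = 0"
proof (induction k arbitrary: i)
  case (Suc k)
  have "fps_nth sinh_sq 0 = 0" "fps_nth sinh_sq 1 = 0"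
    by (simp_all add: sinh_sq_def fps_numeral_nth)
  then have z: "fps_nth sinh_sq l = 0" if "l < 2" for l
    using that by (cases l) auto
  show ?case
    unfolding power_Suc fps_mult_nth
  proof (rule sum.neutral, safe)
    fix l assume "l \<in> {0..i}"
    with Suc show "fps_nth sinh_sq l * fps_nth (sinh_sq ^ k) (i - l) = 0"
      by (cases "l < 2") (auto simp: z)
  qed
qed simp

lemma weight_egf_nth: "fps_nth (weight_egf k) (2 * j) = real (central_weight j k) / fact (2 * j)"
proof (induction j arbitrary: k)
  case 0
  show ?case
    by (cases "k = 0") (simp_all add: weight_egf_def sinh_sq_power_nth)
next
  case (Suc j)
  have "real (2 * j + 2) * real (2 * j + 1) * fps_nth (weight_egf k) (2 * j + 2) =
      fps_nth (fps_deriv (fps_deriv (weight_egf k))) (2 * j)"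
    by (simp add: algebra_simps)
  also have "\<dots> = real (central_weight (Suc j) k) / fact (2 * j)"
    unfolding deriv2_weight_egf by (simp add: Suc.IH add_divide_distrib distrib_left)
  finally show ?case
    by (simp add: divide_simps) (simp add: algebra_simps)
qed

text \<open>A finite sum suffices: \<open>weight_egf k\<close> begins at \<open>x^(2k)\<close>, so
  terms beyond \<open>N\<close> cannot affect coefficients below \<open>2 * N + 2\<close>.\<close>

definition alt_weight_sum :: "nat \<Rightarrow> real fps" where
  "alt_weight_sum N = (\<Sum>k\<le>N. (-1) ^ k * weight_egf k)"

section \<open>The differential equation of the alternating sum\<close>

lemma fps_deriv_minus_one_power_mult:
  "fps_deriv ((-1) ^ n * f) = (-1) ^ n * fps_deriv (f :: 'a :: comm_ring_1 fps)"
  by (cases "even n") simp_all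

text \<open>Summation by parts with \<open>k^2 - (k+1)^2 = -(2k+1)\<close>; cutting off at
  \<open>N\<close> leaves the boundary term.\<close>

lemma deriv2_alt_weight_sum:
  "fps_deriv (fps_deriv (alt_weight_sum N)) =
     (-1) ^ N * fps_const ((real (Suc N))\<^sup>2) * weight_egf N
     - (\<Sum>k\<le>N. (-1) ^ k * fps_const (2 * real k + 1) * weight_egf k)"
proof (induction N)
  case 0
  show ?case by (simp add: alt_weight_sum_def weight_egf_def)
next
  case (Suc N)
  have c: "fps_const ((real (Suc (Suc N)))\<^sup>2) =
      fps_const ((real (Suc N))\<^sup>2) + fps_const (2 * real (Suc N) + 1)"
    by (simp add: power2_eq_square algebra_simps)
  have "fps_deriv (fps_deriv (alt_weight_sum (Suc N))) = fps_deriv (fps_deriv (alt_weight_sum N)) +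
     (-1) ^ Suc N * fps_const ((real (Suc N))\<^sup>2) * (weight_egf (Suc N) + weight_egf N)"
    by (simp add: alt_weight_sum_def fps_deriv_minus_one_power_mult deriv2_weight_egf mult.assoc del: power_Suc fps_deriv_mult)
  then show ?case
    unfolding Suc.IH c by (simp add: algebra_simps del: of_nat_Suc fps_const_add)
qed

text \<open>The mixed term of the product rule contributes weights \<open>2 * k\<close>, which
  cancel those in \<open>2 * k + 1\<close>. The remaining \<open>cosh_sq * alt_weight_sum N\<close>
  cancels against the second derivative of \<open>cosh_sq\<close>, leaving only the boundary
  term.\<close>

lemma alt_weight_sum_ode:
  "fps_deriv (fps_deriv (cosh_sq * alt_weight_sum N)) + fps_const (1/2) * alt_weight_sum N =
     (-1) ^ N * fps_const ((real (Suc N))\<^sup>2) * cosh_sq * weight_egf N"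
proof -
  have d1: "2 * fps_deriv cosh_sq = sinh_fps"
    by (simp add: cosh_sq_def deriv_sinh_sq numeral_fps_const flip: mult.assoc)
  have d2: "fps_deriv (fps_deriv cosh_sq) = cosh_sq - fps_const (1/2)"
    by (simp add: fps_eq_iff cosh_sq_def sinh_sq_def fps_numeral_nth divide_simps)
  have s: "sinh_fps * fps_deriv (alt_weight_sum N) =
      cosh_sq * (\<Sum>k\<le>N. (-1) ^ k * fps_const (2 * real k) * weight_egf k)"
    unfolding alt_weight_sum_def fps_deriv_sum sum_distrib_left
    by (rule sum.cong) (simp_all add: fps_deriv_minus_one_power_mult mult.left_commute mult.assoc deriv_weight_egf
        del: fps_const_mult fps_deriv_mult)
  have t: "(\<Sum>k\<le>N. (-1) ^ k * fps_const (2 * real k + 1) * weight_egf k) =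
     (\<Sum>k\<le>N. (-1) ^ k * fps_const (2 * real k) * weight_egf k) + alt_weight_sum N"
    unfolding alt_weight_sum_def sum.distrib[symmetric]
    by (rule sum.cong) (simp_all add: algebra_simps flip: fps_const_add)
  have "fps_deriv (fps_deriv (cosh_sq * alt_weight_sum N)) + fps_const (1/2) * alt_weight_sum N =
     cosh_sq * fps_deriv (fps_deriv (alt_weight_sum N)) + (2 * fps_deriv cosh_sq) * fps_deriv (alt_weight_sum N)
     + cosh_sq * alt_weight_sum N"
    by (simp add: d2 algebra_simps)
  also have "\<dots> = (-1) ^ N * fps_const ((real (Suc N))\<^sup>2) * cosh_sq * weight_egf N"
    unfolding d1 s deriv2_alt_weight_sum t by (simp add: algebra_simps)
  finally show ?thesis .
qed

text \<open>\<open>x tanh (x/2)\<close>, the even part of the Genocchi series up to sign.\<close>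

definition tanh_egf :: "real fps" where
  "tanh_egf = fps_X - Abs_fps (\<lambda>n. genocchi n / fact n)"

lemma tanh_egf_eq: "tanh_egf * (fps_exp 1 + 1) = fps_X * (fps_exp 1 - 1)"
  unfolding tanh_egf_def left_diff_distrib genocchi_egf by (simp add: algebra_simps)

text \<open>Differentiated twice, this says that the second derivative of \<open>tanh_egf\<close>
  solves the equation of \<open>alt_weight_sum_ode\<close> with right-hand side 0.\<close>

lemma cosh_sq_deriv2_tanh: "cosh_sq * fps_deriv (fps_deriv tanh_egf) = 1 - fps_const (1/2) * tanh_egf"
proof -
  let ?P = tanh_egf and ?E = "fps_exp (1::real)"
  have 1: "fps_deriv ?P * (?E + 1) + ?P * ?E = ?E - 1 + fps_X * ?E"
    using arg_cong[OF tanh_egf_eq, of fps_deriv] by (simp add: algebra_simps)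
  have 2: "fps_deriv (fps_deriv ?P) * (?E + 1) + 2 * fps_deriv ?P * ?E + ?P * ?E = 2 * ?E + fps_X * ?E"
    using arg_cong[OF 1, of fps_deriv] by (simp add: algebra_simps)
  \<comment> \<open>The factor \<open>?E\<close> turns \<open>4 * cosh_sq\<close> into the squared
    denominator of \<open>tanh_egf\<close>, which makes the claim polynomial.\<close>
  have c4: "4 * cosh_sq * ?E = (?E + 1)\<^sup>2"
  proof -
    have "4 * cosh_sq = 2 + ?E + fps_exp (-1)"
      by (simp add: cosh_sq_def sinh_sq_def numeral_fps_const algebra_simps flip: mult.assoc)
    then show ?thesis using exp_mult_exp_minus by algebra
  qed
  have half: "2 * fps_const (1/2) = (1 :: real fps)"
    by (simp add: numeral_fps_const)
  have "4 * ?E * (cosh_sq * fps_deriv (fps_deriv ?P)) = 4 * ?E * (1 - fps_const (1/2) * ?P)"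
    using 1 2 c4 half tanh_egf_eq by algebra
  then show ?thesis by simp
qed

text \<open>Coefficient \<open>l\<close> of the equation contains coefficient \<open>l + 2\<close>
  of \<open>D\<close> with a nonzero factor and otherwise only lower ones. This explains the gain
  from \<open>M\<close> to \<open>M + 2\<close>.\<close>

lemma fps_ode_unique:
  fixes C D :: "'a :: field_char_0 fps"
  assumes C: "fps_nth C 0 = 1" and D: "fps_nth D 0 = 0" "fps_nth D 1 = 0"
    and ode: "\<And>i. i < M \<Longrightarrow> fps_nth (fps_deriv (fps_deriv (C * D)) + fps_const c * D) i = 0"
  shows "i < M + 2 \<Longrightarrow> fps_nth D i = 0"
proof (induction i rule: less_induct)
  case (less i)
  consider "i = 0" | "i = 1" | l where "i = l + 2"
    by (metis One_nat_def add_2_eq_Suc' nat.exhaust)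
  then show ?case
  proof cases
    case 3
    have "fps_nth (C * D) i = (\<Sum>m=0..i. fps_nth C m * fps_nth D (i - m))"
      by (simp add: fps_mult_nth)
    also have "\<dots> = (\<Sum>m\<in>{0}. fps_nth C m * fps_nth D (i - m))"
      by (rule sum.mono_neutral_right) (use less in auto)
    finally have "fps_nth (C * D) i = fps_nth D i"
      using C by simp
    moreover have "of_nat (l + 1) * of_nat (l + 2) * fps_nth (C * D) (l + 2) = 0"
      using ode[of l] less 3 by (simp add: mult_ac del: fps_deriv_mult)
    ultimately show ?thesis
      using 3 by (simp del: of_nat_Suc of_nat_add)
  qed (use D in auto)
qed

text \<open>The truncated sum and the second derivative of \<open>tanh_egf\<close> satisfy the same
  equation up to a remainder that starts at order \<open>2 * j\<close>, so their coefficients at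
  \<open>2 * j\<close> agree.\<close>

lemma alternating_central_weight_sum:
  "(\<Sum>k\<le>j. (-1) ^ k * real (central_weight j k)) = - genocchi (2 * Suc j)"
proof -
  let ?Psi = "fps_deriv (fps_deriv tanh_egf)"
  define D where "D = alt_weight_sum j - ?Psi"
  have C: "fps_nth cosh_sq 0 = 1" "fps_nth cosh_sq 1 = 0"
    by (simp_all add: cosh_sq_def sinh_sq_def fps_numeral_nth)
  have P: "fps_nth tanh_egf 0 = 0" "fps_nth tanh_egf 1 = 0"
    using arg_cong[OF tanh_egf_eq, of "\<lambda>f. fps_nth f 0"] arg_cong[OF tanh_egf_eq, of "\<lambda>f. fps_nth f 1"]
    by (auto simp: fps_mult_nth_1)
  have Psi: "fps_nth ?Psi 0 = 1" "fps_nth ?Psi 1 = 0"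
    using arg_cong[OF cosh_sq_deriv2_tanh, of "\<lambda>f. fps_nth f 0"]
      arg_cong[OF cosh_sq_deriv2_tanh, of "\<lambda>f. fps_nth f 1"]
    by (auto simp: fps_mult_nth_1 C[unfolded One_nat_def] P[unfolded One_nat_def] simp del: fps_deriv_nth)
  have w: "fps_nth (weight_egf k) i = (if k = 0 \<and> i = 0 then 1 else 0)" if "i < 2" for i k
    using that by (cases k) (auto simp: weight_egf_def sinh_sq_power_nth simp del: power_Suc)
  have s: "fps_nth ((-1) ^ k * f) i = (-1) ^ k * fps_nth f i" for k i and f :: "real fps"
    by (cases "even k") simp_all
  have "fps_nth (alt_weight_sum j) 0 = 1" "fps_nth (alt_weight_sum j) 1 = 0"
    by (simp_all add: alt_weight_sum_def fps_sum_nth s w if_distrib cong: if_cong)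
  then have D: "fps_nth D 0 = 0" "fps_nth D 1 = 0"
    unfolding D_def fps_sub_nth Psi by simp_all
  have "fps_deriv (fps_deriv (cosh_sq * D)) + fps_const (1/2) * D =
     (-1) ^ j * fps_const ((real (Suc j))\<^sup>2) * cosh_sq * weight_egf j"
    unfolding D_def right_diff_distrib cosh_sq_deriv2_tanh alt_weight_sum_ode[symmetric]
    by simp
  moreover have "fps_nth ((-1) ^ j * fps_const ((real (Suc j))\<^sup>2) * cosh_sq * weight_egf j) i = 0"
    if "i < 2 * j" for i
    using that unfolding mult.assoc s fps_mult_nth
    by (auto simp: weight_egf_def sinh_sq_power_nth intro!: sum.neutral)
  ultimately have "fps_nth D (2 * j) = 0"
    using fps_ode_unique[of cosh_sq D "2 * j" "1/2" "2 * j"] C D by simp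
  moreover have "fps_nth (alt_weight_sum j) (2 * j) =
      (\<Sum>k\<le>j. (-1) ^ k * real (central_weight j k)) / fact (2 * j)"
    by (simp add: alt_weight_sum_def fps_sum_nth s weight_egf_nth sum_divide_distrib)
  \<comment> \<open>The summand \<open>fps_X\<close> of \<open>tanh_egf\<close> does not reach
    coefficient \<open>2 * j + 2\<close>.\<close>
  moreover have "fps_nth ?Psi (2 * j) = - genocchi (2 * Suc j) / fact (2 * j)"
    by (simp add: tanh_egf_def divide_simps)
  ultimately have "(\<Sum>k\<le>j. (-1) ^ k * real (central_weight j k)) / fact (2 * j) =
      - genocchi (2 * Suc j) / fact (2 * j)"
    by (simp add: D_def del: fps_deriv_nth)
  then show ?thesis
    by (simp only: divide_cancel_right) simp
qed

subsection \<open>Counting\<close>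

lemma finite_tournaments: "finite {T. tournament n T}"
proof (rule finite_subset)
  show "{T. tournament n T} \<subseteq> Pow ({1..n} \<times> {1..n})"
    unfolding tournament_def by blast
qed simp

text \<open>Both ends exceed some vertex \<open>i\<close>, so vertex 1 is in no constraint and level
  functions live on \<open>{2..n}\<close>.\<close>

lemma forced_subset:
  assumes "tournament n T"
  shows "forced T \<subseteq> {2..n} \<times> {2..n}"
proof (rule subrelI)
  fix w v assume "(w, v) \<in> forced T"
  then obtain i where i: "i < w" "i < v" "(w, i) \<in> T" "(i, v) \<in> T"
    by (auto simp: forced_def)
  then show "(w, v) \<in> {2..n} \<times> {2..n}"
    using tournament_arc[OF assms i(3)] tournament_arc[OF assms i(4)] by simp
qed

lemma strict_surj_forced:
  assumes "tournament n T"
  shows "strict_surj (forced T) {2..n} k =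
    {h \<in> strict_surj {} {2..n} k. \<forall>(w, v) \<in> forced T. h w < h v}"
proof -
  have "(\<forall>(w, v) \<in> forced T. w \<in> {2..n} \<longrightarrow> v \<in> {2..n} \<longrightarrow> h w < h v) \<longleftrightarrow>
      (\<forall>(w, v) \<in> forced T. h w < h v)" for h :: "nat \<Rightarrow> nat"
    using forced_subset[OF assms] by (intro ball_cong) auto
  then show ?thesis
    by (simp add: strict_surj_def)
qed

text \<open>The indicator of alternation acyclicity becomes a signed count; \<open>n - 1\<close> is
  the size of \<open>{2..n}\<close>.\<close>

lemma alternating_sum_strict_surj_forced:
  assumes T: "tournament n T"
  shows "(\<Sum>k\<le>n - 1. (-1) ^ k * int (card (strict_surj (forced T) {2..n} k))) =
    (if alternation_acyclic T then (-1) ^ (n - 1) else 0)"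
proof (cases "alternation_acyclic T")
  case True
  have "(\<Sum>k\<le>n - 1. (-1) ^ k * int (card (strict_surj (forced T) {2..n} k))) = (-1) ^ card {2..n}"
  proof (rule alternating_sum_strict_surj)
    fix U :: "nat set" assume "U \<subseteq> {2..n}" "U \<noteq> {}"
    moreover from this have "U \<subseteq> {1..n}" by force
    ultimately show "\<exists>v\<in>U. \<forall>w\<in>U. (v, w) \<notin> forced T"
      using forced_has_maximal[OF T True] by blast
  qed simp_all
  then show ?thesis using True by simp
next
  case False
  then have "strict_surj (forced T) {2..n} k = {}" for k
    unfolding strict_surj_forced[OF T] using alternation_acyclic_if_strict by blast
  then show ?thesis using False by simp
qed

text \<open>Double counting of pairs of a tournament and a compatible surjection.\<close>

lemma sum_card_strict_surj_forced:
  assumes "n \<ge> 1"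
  shows "(\<Sum>T | tournament n T \<and> ascending n T. card (strict_surj (forced T) {2..n} k)) =
    central_weight (n - 1) k"
proof -
  let ?S = "{T. tournament n T \<and> ascending n T}"
  let ?H = "strict_surj {} {2..n} k"
  let ?strict = "\<lambda>h T. \<forall>(w, v) \<in> forced T. h w < (h v :: nat)"
  have S: "finite ?S"
    using finite_tournaments[of n] by (rule rev_finite_subset) blast
  have H: "finite ?H" by (simp add: finite_strict_surj)
  have "(\<Sum>T\<in>?S. card (strict_surj (forced T) {2..n} k)) = (\<Sum>T\<in>?S. card {h \<in> ?H. ?strict h T})"
    by (rule sum.cong) (simp_all add: strict_surj_forced)
  also have "\<dots> = (\<Sum>T\<in>?S. \<Sum>h\<in>?H. if ?strict h T then 1 else 0)"
    by (simp only: card_eq_sum sum.inter_filter[OF H])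
  also have "\<dots> = (\<Sum>h\<in>?H. \<Sum>T\<in>?S. if ?strict h T then 1 else 0)"
    by (rule sum.swap)
  also have "\<dots> = (\<Sum>h\<in>?H. card {T \<in> ?S. ?strict h T})"
    by (simp only: card_eq_sum sum.inter_filter[OF S])
  also have "\<dots> = (\<Sum>h\<in>?H. \<Prod>i\<in>{1..<n}. card (h ` {Suc i..n}))"
    using card_ascending_strict_tournaments[of n] by (simp only: mem_Collect_eq conj_assoc)
  finally show ?thesis
    unfolding sum_surj_weights[OF assms] .
qed

theorem theorem6p3:
  fixes n :: nat
  assumes "n \<ge> 1"
  shows "real (card {T. tournament n T \<and> alternation_acyclic T \<and> ascending n T})
           = \<bar>genocchi (2 * n)\<bar>"
proof -
  let ?S = "{T. tournament n T \<and> ascending n T}"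
  let ?A = "{T. tournament n T \<and> alternation_acyclic T \<and> ascending n T}"
  have S: "finite ?S"
    using finite_tournaments[of n] by (rule rev_finite_subset) blast
  have A: "?A = {T \<in> ?S. alternation_acyclic T}" by blast
  have "(-1) ^ (n - 1) * int (card ?A) = (\<Sum>T\<in>?S. if alternation_acyclic T then (-1) ^ (n - 1) else 0)"
    unfolding A sum.inter_filter[OF S, symmetric] by simp
  also have "\<dots> = (\<Sum>T\<in>?S. \<Sum>k\<le>n - 1. (-1) ^ k * int (card (strict_surj (forced T) {2..n} k)))"
    by (rule sum.cong) (simp_all only: mem_Collect_eq alternating_sum_strict_surj_forced)
  also have "\<dots> = (\<Sum>k\<le>n - 1. (-1) ^ k * int (\<Sum>T\<in>?S. card (strict_surj (forced T) {2..n} k)))"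
    by (subst sum.swap) (simp add: sum_distrib_left)
  also have "\<dots> = (\<Sum>k\<le>n - 1. (-1) ^ k * int (central_weight (n - 1) k))"
    unfolding sum_card_strict_surj_forced[OF assms] ..
  finally have "real_of_int ((-1) ^ (n - 1) * int (card ?A)) =
      real_of_int (\<Sum>k\<le>n - 1. (-1) ^ k * int (central_weight (n - 1) k))"
    by (rule arg_cong)
  also have "\<dots> = (\<Sum>k\<le>n - 1. (-1) ^ k * real (central_weight (n - 1) k))"
    by simp
  also have "\<dots> = - genocchi (2 * n)"
    using alternating_central_weight_sum[of "n - 1"] assms by simp
  \<comment> \<open>Absolute values remove both \<open>(-1) ^ (n - 1)\<close> and the sign of the
    Genocchi number.\<close>
  finally have "\<bar>(-1) ^ (n - 1) * real (card ?A)\<bar> = \<bar>genocchi (2 * n)\<bar>"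
    by simp
  then show ?thesis
    by (simp add: abs_mult power_abs)
qed

end
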